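(* Let $\alpha$ be a primitive substitution of constant length $L>1$ such that $X_\alpha$ is infinite. Then, up to renaming of symbols, there are only finitely many injective primitive substitutions $\beta$ of constant length $L$ such that $(X_\beta,\sigma)$ is topologically conjugate to $(X_\alpha,\sigma)$.
   Context: An alphabet is a finite set $A$ with at least two elements. A substitution on $A$ is a map $\alpha:A\to A^*$, extended to finite and infinite words by juxtaposition; it has constant length $L$ if $\alpha(a)\in A^L$ for every $a\in A$. It is injective if $\alpha(a)\ne\alpha(b)$ for distinct letters $a,b$. It is primitive if for some $n>0$ and every $a\in A$ the word $\alpha^n(a)$ contains every letter of $A$. The language $\mathcal{L}_\alpha\subseteq A^*$ is the set of all factors (words of consecutive letters) of words $\alpha^n(a)$, $a\in A$, $n\ge 1$. $X_\alpha\subseteq A^{\mathbb{Z}}$ is the set of bi-infinite sequences all of whose finite factors lie in $\mathcal{L}_\alpha$, and $\sigma$ is the left shift. Two systems are topologically conjugate if there is a homeomorphism between them commuting with $\sigma$. Substitutions differing only by a bijective renaming of the symbols of the alphabet are regarded as the same. *)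

theory Defs
  imports "HOL-Analysis.Analysis" "HOL-Library.Sublist"
begin

definition alphabet :: "'a set \<Rightarrow> bool" where
  "alphabet A \<longleftrightarrow> finite A \<and> card A \<ge> 2"

text \<open>A substitution on \<open>A\<close> is represented by a total function on the ambient type;
  its values outside \<open>A\<close> are irrelevant.\<close>

definition substitution :: "'a set \<Rightarrow> ('a \<Rightarrow> 'a list) \<Rightarrow> bool" where
  "substitution A \<alpha> \<longleftrightarrow> alphabet A \<and> (\<forall>a\<in>A. \<alpha> a \<in> lists A)"

definition subst_word :: "('a \<Rightarrow> 'a list) \<Rightarrow> 'a list \<Rightarrow> 'a list" where
  "subst_word \<alpha> w = concat (map \<alpha> w)"

definition subst_iter :: "('a \<Rightarrow> 'a list) \<Rightarrow> nat \<Rightarrow> 'a \<Rightarrow> 'a list" where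
  "subst_iter \<alpha> n a = (subst_word \<alpha> ^^ n) [a]"

definition constant_length :: "'a set \<Rightarrow> ('a \<Rightarrow> 'a list) \<Rightarrow> nat \<Rightarrow> bool" where
  "constant_length A \<alpha> L \<longleftrightarrow> (\<forall>a\<in>A. length (\<alpha> a) = L)"

definition primitive_subst :: "'a set \<Rightarrow> ('a \<Rightarrow> 'a list) \<Rightarrow> bool" where
  "primitive_subst A \<alpha> \<longleftrightarrow> (\<exists>n>0. \<forall>a\<in>A. A \<subseteq> set (subst_iter \<alpha> n a))"

definition subst_language :: "'a set \<Rightarrow> ('a \<Rightarrow> 'a list) \<Rightarrow> 'a list set" where
  "subst_language A \<alpha> = {w. \<exists>a\<in>A. \<exists>n\<ge>1. sublist w (subst_iter \<alpha> n a)}"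

definition subst_shift :: "'a set \<Rightarrow> ('a \<Rightarrow> 'a list) \<Rightarrow> (int \<Rightarrow> 'a) set" where
  "subst_shift A \<alpha> = {x. range x \<subseteq> A \<and>
     (\<forall>i n. map (\<lambda>k. x (i + int k)) [0..<n] \<in> subst_language A \<alpha>)}"

definition left_shift :: "(int \<Rightarrow> 'a) \<Rightarrow> (int \<Rightarrow> 'a)" where
  "left_shift x = (\<lambda>i. x (i + 1))"

definition subst_topology :: "'a set \<Rightarrow> ('a \<Rightarrow> 'a list) \<Rightarrow> (int \<Rightarrow> 'a) topology" where
  "subst_topology A \<alpha> =
     subtopology (product_topology (\<lambda>_. discrete_topology A) UNIV) (subst_shift A \<alpha>)"

lemma topspace_subst_topology: "topspace (subst_topology A \<alpha>) = subst_shift A \<alpha>"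
  by (auto simp: subst_topology_def subst_shift_def)

definition topologically_conjugate ::
  "'a set \<Rightarrow> ('a \<Rightarrow> 'a list) \<Rightarrow> 'b set \<Rightarrow> ('b \<Rightarrow> 'b list) \<Rightarrow> bool" where
  "topologically_conjugate A \<alpha> B \<beta> \<longleftrightarrow>
     (\<exists>h. homeomorphic_map (subst_topology A \<alpha>) (subst_topology B \<beta>) h \<and>
          (\<forall>x\<in>subst_shift A \<alpha>. h (left_shift x) = left_shift (h x)))"

text \<open>Pairs with the same alphabet whose maps agree on it are renamings of each other (via the
  identity), so the quotient also discards the values outside the alphabet.\<close>

definition renaming :: "(('a set \<times> ('a \<Rightarrow> 'a list)) \<times> ('a set \<times> ('a \<Rightarrow> 'a list))) set" where
  "renaming = {((A, \<alpha>), (B, \<beta>)). substitution A \<alpha> \<and> substitution B \<beta> \<and>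
     (\<exists>f. bij_betw f A B \<and> (\<forall>a\<in>A. \<beta> (f a) = map f (\<alpha> a)))}"

lemma equiv_renaming: "equiv {(A :: 'a set, \<alpha>). substitution A \<alpha>} renaming"
  (is "equiv ?S ?R")
proof (rule equivI)
  show "?R \<subseteq> ?S \<times> ?S"
    by (auto simp: renaming_def)
  show "refl_on ?S ?R"
    by (auto simp: refl_on_def renaming_def intro!: exI[of _ id])
  show "sym ?R"
  proof (rule symI, clarify)
    fix A B :: "'a set" and \<alpha> \<beta> :: "'a \<Rightarrow> 'a list"
    assume "((A, \<alpha>), (B, \<beta>)) \<in> renaming"
    then obtain f where s: "substitution A \<alpha>" "substitution B \<beta>" and f: "bij_betw f A B"
      and e: "\<And>a. a \<in> A \<Longrightarrow> \<beta> (f a) = map f (\<alpha> a)"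
      by (auto simp: renaming_def)
    let ?g = "inv_into A f"
    have "\<alpha> (?g b) = map ?g (\<beta> b)" if "b \<in> B" for b
    proof -
      have a: "?g b \<in> A" and fb: "f (?g b) = b"
        using f that by (auto simp: bij_betw_def inv_into_into f_inv_into_f)
      have "map ?g (\<beta> b) = map ?g (map f (\<alpha> (?g b)))"
        using e[OF a] fb by simp
      also have "\<dots> = map (\<lambda>x. ?g (f x)) (\<alpha> (?g b))"
        by simp
      also have "\<dots> = \<alpha> (?g b)"
        using s(1) a f by (intro map_idI) (auto simp: substitution_def bij_betw_def)
      finally show ?thesis by (rule sym)
    qed
    then show "((B, \<beta>), (A, \<alpha>)) \<in> renaming"
      using s bij_betw_inv_into[OF f] by (auto simp: renaming_def)
  qed
  show "trans ?R"
  proof (rule transI, clarify)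
    fix A B C :: "'a set" and \<alpha> \<beta> \<gamma> :: "'a \<Rightarrow> 'a list"
    assume "((A, \<alpha>), (B, \<beta>)) \<in> renaming" "((B, \<beta>), (C, \<gamma>)) \<in> renaming"
    then obtain f g where "substitution A \<alpha>" "substitution C \<gamma>"
      and f: "bij_betw f A B" and g: "bij_betw g B C"
      and e: "\<And>a. a \<in> A \<Longrightarrow> \<beta> (f a) = map f (\<alpha> a)" "\<And>b. b \<in> B \<Longrightarrow> \<gamma> (g b) = map g (\<beta> b)"
      by (auto simp: renaming_def)
    moreover have "\<gamma> ((g \<circ> f) a) = map (g \<circ> f) (\<alpha> a)" if "a \<in> A" for a
      using e that f by (auto simp: bij_betw_def)
    ultimately show "((A, \<alpha>), (C, \<gamma>)) \<in> renaming"
      using bij_betw_trans[OF f g] unfolding renaming_def by blast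
  qed
qed

end

theory Submission imports Defs begin

text \<open>Everything reduces to a bound on the size of the alphabet \<open>B\<close> of \<open>\<beta>\<close>, because up to
  renaming there are only finitely many substitutions of length \<open>L\<close> on alphabets of bounded size.
  Let \<open>F : X\<^sub>\<alpha> \<rightarrow> X\<^sub>\<beta>\<close> be the conjugacy; by compactness it is a sliding block code, of radius
  \<open>r \<le> L\<^sup>k\<close> say. Fix \<open>x \<in> X\<^sub>\<alpha>\<close> and put \<open>z = F (\<alpha>\<^sup>k x)\<close>. By primitivity of \<open>\<beta>\<close>, the words \<open>\<beta>\<^sup>k(d)\<close>
  for all letters \<open>d \<in> B\<close> occur in \<open>z\<close> at positions in one residue class modulo \<open>L\<^sup>k\<close>, and each
  of them is determined by the four letters of \<open>x\<close> whose \<open>\<alpha>\<^sup>k\<close>-images cover its neighbourhood of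
  radius \<open>r\<close>. As \<open>\<beta>\<^sup>k\<close> is injective, \<open>card B \<le> card A ^ 4\<close>.\<close>

subsection \<open>Iterated substitutions\<close>

lemma subst_word_simps [simp]:
  "subst_word \<gamma> [] = []"
  "subst_word \<gamma> (a # w) = \<gamma> a @ subst_word \<gamma> w"
  "subst_word \<gamma> (u @ v) = subst_word \<gamma> u @ subst_word \<gamma> v"
  by (simp_all add: subst_word_def)

text \<open>Both sides respect concatenation and agree on single letters. Powers of \<alpha> thus
  become substitutions in their own right, and everything proved for a general \<gamma> applies to
  \<open>subst_iter \<alpha> n\<close>.\<close>

lemma funpow_subst_word: "(subst_word \<alpha> ^^ n) w = subst_word (subst_iter \<alpha> n) w"
proof -
  have append: "(subst_word \<alpha> ^^ n) (u @ v) = (subst_word \<alpha> ^^ n) u @ (subst_word \<alpha> ^^ n) v"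
    for u v by (induction n) auto
  have nil: "(subst_word \<alpha> ^^ n) [] = []"
    by (induction n) auto
  show ?thesis
  proof (induction w)
    case (Cons a w)
    then show ?case
      using append[of "[a]" w] by (simp add: subst_iter_def)
  qed (simp add: nil)
qed

lemma subst_iter_add: "subst_iter \<alpha> (m + n) a = subst_word (subst_iter \<alpha> m) (subst_iter \<alpha> n a)"
  by (metis comp_apply funpow_add funpow_subst_word subst_iter_def)

lemma subst_iter_0 [simp]: "subst_iter \<alpha> 0 a = [a]"
  by (simp add: subst_iter_def)

lemma subst_iter_Suc: "subst_iter \<alpha> (Suc n) a = subst_word (subst_iter \<alpha> n) (\<alpha> a)"
  using subst_iter_add[of \<alpha> n 1 a] by (simp add: subst_iter_def)

lemma length_subst_word:
  assumes "constant_length A \<gamma> M" "w \<in> lists A"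
  shows "length (subst_word \<gamma> w) = length w * M"
  using assms(2,1) by (induction w) (auto simp: constant_length_def)

lemma subst_word_in_lists:
  assumes "\<forall>a\<in>A. \<gamma> a \<in> lists A" "w \<in> lists A"
  shows "subst_word \<gamma> w \<in> lists A"
  using assms(2,1) by (induction w) auto

lemma subst_iter_in_lists:
  assumes "\<forall>a\<in>A. \<alpha> a \<in> lists A" "a \<in> A"
  shows "subst_iter \<alpha> n a \<in> lists A"
  using assms(2)
proof (induction n arbitrary: a)
  case (Suc n)
  then show ?case
    using assms(1) unfolding subst_iter_Suc by (intro subst_word_in_lists) auto
qed auto

lemma constant_length_subst_iter:
  assumes "\<forall>a\<in>A. \<alpha> a \<in> lists A" "constant_length A \<alpha> L"
  shows "constant_length A (subst_iter \<alpha> n) (L ^ n)"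
proof (induction n)
  case (Suc n)
  then show ?case
    using assms length_subst_word[OF Suc] by (auto simp: constant_length_def subst_iter_Suc)
qed (simp add: constant_length_def)

text \<open>As all blocks have the same length M, equal images are cut into blocks at the same
  places, so letters can be compared one by one.\<close>

lemma inj_on_subst_word:
  assumes "constant_length A \<gamma> M" "inj_on \<gamma> A" "u \<in> lists A" "v \<in> lists A" "length u = length v"
    and "subst_word \<gamma> u = subst_word \<gamma> v"
  shows "u = v"
  using assms(5,3,4,6)
proof (induction rule: list_induct2)
  case (Cons a u b v)
  then have "length (\<gamma> a) = length (\<gamma> b)"
    using assms(1) by (auto simp: constant_length_def)
  with Cons assms(2) show ?case
    by (auto dest: inj_onD)
qed simp

text \<open>Peeling off the innermost application leaves \<alpha> a and \<alpha> b, two words of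
  equal length L; the induction hypothesis, extended from letters to words, identifies them.\<close>

lemma inj_on_subst_iter:
  assumes "\<forall>a\<in>A. \<alpha> a \<in> lists A" "constant_length A \<alpha> L" "inj_on \<alpha> A"
  shows "inj_on (subst_iter \<alpha> n) A"
proof (induction n)
  case (Suc n)
  show ?case
  proof (rule inj_onI)
    fix a b assume ab: "a \<in> A" "b \<in> A" and eq: "subst_iter \<alpha> (Suc n) a = subst_iter \<alpha> (Suc n) b"
    have "\<alpha> a = \<alpha> b"
      by (rule inj_on_subst_word[OF constant_length_subst_iter[OF assms(1,2)] Suc])
        (use ab eq assms in \<open>auto simp: subst_iter_Suc constant_length_def\<close>)
    with ab assms(3) show "a = b"
      by (auto dest: inj_onD)
  qed
qed (simp add: inj_on_def)

lemma take_drop_subst_word: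
  assumes "constant_length A \<gamma> M" "w \<in> lists A" "i < length w"
  shows "take M (drop (i * M) (subst_word \<gamma> w)) = \<gamma> (w ! i)"
  using assms(2,3)
proof (induction w arbitrary: i)
  case (Cons a w)
  have "length (\<gamma> a) = M"
    using Cons assms(1) by (auto simp: constant_length_def)
  with Cons show ?case
    by (cases i) auto
qed simp

subsection \<open>Factors of bi-infinite sequences\<close>

definition factor :: "(int \<Rightarrow> 'a) \<Rightarrow> int \<Rightarrow> nat \<Rightarrow> 'a list" where
  "factor x i n = map (\<lambda>k. x (i + int k)) [0..<n]"

lemma length_factor [simp]: "length (factor x i n) = n"
  by (simp add: factor_def)

lemma nth_factor [simp]: "k < n \<Longrightarrow> factor x i n ! k = x (i + int k)"
  by (simp add: factor_def)

lemma factor_add: "factor x i (m + n) = factor x i m @ factor x (i + int m) n"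
  by (rule nth_equalityI) (auto simp: nth_append algebra_simps of_nat_diff)

lemma take_drop_factor:
  assumes "j + m \<le> n"
  shows "take m (drop j (factor x i n)) = factor x (i + int j) m"
  using assms by (intro nth_equalityI) (auto simp: algebra_simps)

lemma sublist_factor:
  assumes "i \<le> j" "j + int m \<le> i + int n"
  shows "sublist (factor x j m) (factor x i n)"
proof -
  have "factor x j m = take m (drop (nat (j - i)) (factor x i n))"
    using assms by (subst take_drop_factor) auto
  then show ?thesis
    by (metis sublist_take sublist_drop sublist_order.order.trans)
qed

lemma subst_shift_iff:
  "x \<in> subst_shift A \<alpha> \<longleftrightarrow> range x \<subseteq> A \<and> (\<forall>i n. factor x i n \<in> subst_language A \<alpha>)"
  by (simp add: subst_shift_def factor_def)

lemma subst_language_sublist: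
  "w \<in> subst_language A \<alpha> \<Longrightarrow> sublist u w \<Longrightarrow> u \<in> subst_language A \<alpha>"
  unfolding subst_language_def by (blast intro: sublist_order.order.trans)

lemma sublist_subst_word: "sublist u w \<Longrightarrow> sublist (subst_word \<gamma> u) (subst_word \<gamma> w)"
  unfolding sublist_def by (metis subst_word_simps(3))

lemma subst_language_subst_word:
  assumes "w \<in> subst_language A \<alpha>"
  shows "subst_word (subst_iter \<alpha> k) w \<in> subst_language A \<alpha>"
proof -
  obtain a n where "a \<in> A" "n \<ge> 1" "sublist w (subst_iter \<alpha> n a)"
    using assms by (auto simp: subst_language_def)
  then have "sublist (subst_word (subst_iter \<alpha> k) w) (subst_iter \<alpha> (k + n) a)"
    by (simp add: subst_iter_add sublist_subst_word)
  moreover have "k + n \<ge> 1"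
    using \<open>n \<ge> 1\<close> by simp
  ultimately show ?thesis
    using \<open>a \<in> A\<close> unfolding subst_language_def by blast
qed

text \<open>The image of a bi-infinite sequence, with the block of the letter at position q placed
  on the positions from q * M up to q * M + M - 1. Rounding \<open>div\<close> down keeps this
  correct at negative positions.\<close>

definition subst_seq :: "nat \<Rightarrow> ('a \<Rightarrow> 'a list) \<Rightarrow> (int \<Rightarrow> 'a) \<Rightarrow> int \<Rightarrow> 'a" where
  "subst_seq M \<gamma> x = (\<lambda>t. \<gamma> (x (t div int M)) ! nat (t mod int M))"

lemma factor_subst_seq:
  assumes "constant_length A \<gamma> M" "range x \<subseteq> A" "M > 0"
  shows "factor (subst_seq M \<gamma> x) (q * int M) (n * M) = subst_word \<gamma> (factor x q n)"
proof (induction n)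
  case (Suc n)
  let ?y = "subst_seq M \<gamma> x"
  have len: "length (\<gamma> (x i)) = M" for i
    using assms(1,2) by (auto simp: constant_length_def)
  have block: "factor ?y (i * int M) M = \<gamma> (x i)" for i
    using len assms(3) by (intro nth_equalityI) (auto simp: subst_seq_def)
  have "factor ?y (q * int M) (Suc n * M)
      = factor ?y (q * int M) (n * M) @ factor ?y ((q + int n) * int M) M"
    using factor_add[of ?y "q * int M" "n * M" M] by (simp add: algebra_simps)
  also have "\<dots> = subst_word \<gamma> (factor x q n @ factor x (q + int n) 1)"
    unfolding Suc block by (simp add: factor_def)
  also have "\<dots> = subst_word \<gamma> (factor x q (Suc n))"
    using factor_add[of x q n 1] by simp
  finally show ?case .
qed (simp add: factor_def)

text \<open>Every factor of the image lies inside the image of a factor of x, and the language is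
  closed under applying \<alpha> and under taking factors.\<close>

lemma subst_seq_in_subst_shift:
  assumes "\<forall>a\<in>A. \<alpha> a \<in> lists A" "constant_length A \<alpha> L" "L > 0" "x \<in> subst_shift A \<alpha>"
  shows "subst_seq (L ^ k) (subst_iter \<alpha> k) x \<in> subst_shift A \<alpha>"
proof -
  define M where "M = L ^ k"
  define y where "y = subst_seq M (subst_iter \<alpha> k) x"
  have M: "M > 0"
    using assms(3) by (simp add: M_def)
  have cl: "constant_length A (subst_iter \<alpha> k) M"
    using constant_length_subst_iter[OF assms(1,2)] by (simp add: M_def)
  have xA: "x i \<in> A" for i
    using assms(4) by (auto simp: subst_shift_def)
  have "y t \<in> A" for t
  proof -
    have "nat (t mod int M) < length (subst_iter \<alpha> k (x (t div int M)))"
      using cl xA M by (simp add: constant_length_def nat_less_iff)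
    then have "y t \<in> set (subst_iter \<alpha> k (x (t div int M)))"
      unfolding y_def subst_seq_def by (rule nth_mem)
    then show ?thesis
      using subst_iter_in_lists[OF assms(1) xA] by blast
  qed
  moreover have "factor y i n \<in> subst_language A \<alpha>" for i n
  proof (rule subst_language_sublist)
    \<comment> \<open>The window starts in block q. Blocks have length at least 1, so n further
      blocks suffice to reach its end; hence \<open>Suc n\<close> letters of x.\<close>
    define q where "q = i div int M"
    show "subst_word (subst_iter \<alpha> k) (factor x q (Suc n)) \<in> subst_language A \<alpha>"
      using assms(4) by (intro subst_language_subst_word) (simp add: subst_shift_iff)
    have "i = q * int M + i mod int M" "i mod int M < int M" "i mod int M \<ge> 0"
      using M by (simp_all add: q_def)
    moreover have "int n \<le> int n * int M"
      using M by (simp add: mult_le_cancel_left1)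
    ultimately have "q * int M \<le> i" "i + int n \<le> q * int M + int (Suc n * M)"
      by (auto simp: algebra_simps)
    then have "sublist (factor y i n) (factor y (q * int M) (Suc n * M))"
      by (rule sublist_factor)
    then show "sublist (factor y i n) (subst_word (subst_iter \<alpha> k) (factor x q (Suc n)))"
      unfolding y_def using factor_subst_seq[OF cl _ M] xA by (metis image_subsetI)
  qed
  ultimately show ?thesis
    unfolding subst_shift_iff y_def M_def by auto
qed

text \<open>A factor of x of length 2 * L^n occurs in some \<alpha>-power of a letter, which is a
  concatenation of blocks of length L^n. A window twice as long as a block contains a complete
  block.\<close>

lemma subst_iter_occurs:
  assumes "\<forall>a\<in>A. \<alpha> a \<in> lists A" "constant_length A \<alpha> L" "L > 1" "x \<in> subst_shift A \<alpha>"
  obtains p c where "c \<in> A" "factor x p (L ^ n) = subst_iter \<alpha> n c"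
proof -
  define M where "M = L ^ n"
  have M: "M > 0"
    using assms(3) by (simp add: M_def)
  have cl: "constant_length A (subst_iter \<alpha> k) (L ^ k)" for k
    using constant_length_subst_iter[OF assms(1,2)] .
  define u where "u = factor x 0 (2 * M)"
  obtain a m where a: "a \<in> A" and sub: "sublist u (subst_iter \<alpha> m a)"
    using assms(4) unfolding subst_shift_iff subst_language_def u_def by blast
  \<comment> \<open>The length of the factor forces n < m, so the m-th power can be split as the
    n-th power applied to the word w below.\<close>
  have "2 * M \<le> L ^ m"
    using sublist_length_le[OF sub] cl a by (simp add: u_def constant_length_def)
  then have "L ^ n < L ^ m"
    using M unfolding M_def by linarith
  then have "n \<le> m"
    using assms(3) by (simp add: power_strict_increasing_iff)
  define w where "w = subst_iter \<alpha> (m - n) a"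
  have w: "w \<in> lists A"
    unfolding w_def by (rule subst_iter_in_lists[OF assms(1) a])
  have "subst_iter \<alpha> m a = subst_word (subst_iter \<alpha> n) w"
    using subst_iter_add[of \<alpha> n "m - n" a] \<open>n \<le> m\<close> by (simp add: w_def)
  then obtain ps ss where split: "subst_word (subst_iter \<alpha> n) w = ps @ u @ ss"
    using sub by (auto simp: sublist_def)
  have lenw: "length w * M = length ps + 2 * M + length ss"
    using length_subst_word[OF cl w, of n] split by (simp add: M_def u_def)
  \<comment> \<open>Rounding up: i is the first block that starts at or after the beginning of u. It
    starts less than M later, hence ends inside u.\<close>
  define i where "i = (length ps + M - 1) div M"
  have "length ps + M - 1 = i * M + (length ps + M - 1) mod M" "(length ps + M - 1) mod M < M"
    using M by (simp_all add: i_def)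
  then have i: "length ps \<le> i * M" "i * M < length ps + M"
    using M by linarith+
  then have "i * M < length w * M"
    using lenw by linarith
  then have iw: "i < length w"
    by simp
  define j where "j = i * M - length ps"
  have j: "i * M = length ps + j" "j + M \<le> 2 * M"
    using i by (auto simp: j_def)
  have "subst_iter \<alpha> n (w ! i) = take M (drop (i * M) (ps @ u @ ss))"
    using take_drop_subst_word[OF cl w iw, of n] by (simp add: split M_def)
  also have "\<dots> = take M (drop j u)"
    using j by (simp add: u_def)
  also have "\<dots> = factor x (int j) M"
    unfolding u_def using j(2) by (simp add: take_drop_factor)
  finally have "factor x (int j) (L ^ n) = subst_iter \<alpha> n (w ! i)"
    by (simp add: M_def)
  moreover have "w ! i \<in> A"
    using iw w by auto
  ultimately show ?thesis
    using that by blast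
qed

subsection \<open>Sliding block codes\<close>

lemma openin_cylinder:
  assumes "finite I" "\<And>i. c i \<in> A"
  shows "openin (product_topology (\<lambda>_. discrete_topology A) UNIV) {x. range x \<subseteq> A \<and> (\<forall>i\<in>I. x i = c i)}"
proof -
  let ?U = "\<lambda>i. if i \<in> I then {c i} else A"
  have "(range x \<subseteq> A \<and> (\<forall>i\<in>I. x i = c i)) \<longleftrightarrow> (\<forall>i. x i \<in> ?U i)" for x
  proof -
    have "x i \<in> A" if "\<forall>i. x i \<in> ?U i" for i
      using that[rule_format, of i] assms(2)[of i] by (cases "i \<in> I") auto
    then show ?thesis
      by (auto split: if_splits)
  qed
  then have "{x. range x \<subseteq> A \<and> (\<forall>i\<in>I. x i = c i)} = Pi\<^sub>E UNIV ?U"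
    by (simp add: PiE_UNIV_domain Pi_def)
  moreover have "finite {i. ?U i \<noteq> A}"
    by (rule finite_subset[OF _ assms(1)]) auto
  then have "openin (product_topology (\<lambda>_. discrete_topology A) UNIV) (Pi\<^sub>E UNIV ?U)"
    using assms(2) by (intro product_topology_basis) auto
  ultimately show ?thesis
    by simp
qed

text \<open>The full shift is compact as a product of finite discrete spaces. The subshift is closed
  in it: if x contains a word outside the language, so does every point of the cylinder fixing the
  positions of that word.\<close>

lemma compact_space_subst_topology:
  assumes "finite A"
  shows "compact_space (subst_topology A \<alpha>)"
proof -
  let ?P = "product_topology (\<lambda>_::int. discrete_topology A) UNIV"
  have top: "topspace ?P = {x. range x \<subseteq> A}"
    by (auto simp: PiE_iff)
  have "openin ?P (topspace ?P - subst_shift A \<alpha>)"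
  proof (subst openin_subopen, safe)
    fix x assume x: "x \<in> topspace ?P" "x \<notin> subst_shift A \<alpha>"
    then have xA: "range x \<subseteq> A"
      using top by blast
    then obtain i n where bad: "factor x i n \<notin> subst_language A \<alpha>"
      using x by (auto simp: subst_shift_iff)
    define U where "U = {y. range y \<subseteq> A \<and> (\<forall>j\<in>{i..<i + int n}. y j = x j)}"
    have "openin ?P U"
      unfolding U_def using xA by (intro openin_cylinder) auto
    moreover have "U \<subseteq> topspace ?P - subst_shift A \<alpha>"
    proof
      fix y assume y: "y \<in> U"
      then have "factor y i n = factor x i n"
        by (auto simp: U_def factor_def)
      with bad have "y \<notin> subst_shift A \<alpha>"
        by (metis subst_shift_iff)
      with y show "y \<in> topspace ?P - subst_shift A \<alpha>"
        unfolding top by (simp add: U_def)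
    qed
    ultimately show "\<exists>T. openin ?P T \<and> x \<in> T \<and> T \<subseteq> topspace ?P - subst_shift A \<alpha>"
      using xA by (auto simp: U_def)
  qed
  then have "closedin ?P (subst_shift A \<alpha>)"
    unfolding closedin_def top by (auto simp: subst_shift_def)
  moreover have "compact_space ?P"
    using assms by (simp add: compact_space_product_topology compact_space_discrete_topology)
  ultimately show ?thesis
    unfolding subst_topology_def by (simp add: closedin_compact_space compact_space_subtopology)
qed

text \<open>The compactness argument of the Curtis-Hedlund-Lyndon theorem. The map sending x to g x
  0 takes values in a discrete space, hence is constant on a central cylinder around each point.
  Finitely many such cylinders cover the shift, and the largest of their radii works
  everywhere.\<close>

lemma continuous_map_subst_topology_radius:
  assumes "finite A" "continuous_map (subst_topology A \<alpha>) (subst_topology B \<beta>) g"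
  obtains r :: nat where
    "\<And>x y. x \<in> subst_shift A \<alpha> \<Longrightarrow> y \<in> subst_shift A \<alpha> \<Longrightarrow> (\<And>i. \<bar>i\<bar> \<le> int r \<Longrightarrow> x i = y i) \<Longrightarrow> g x 0 = g y 0"
proof -
  let ?P = "product_topology (\<lambda>_::int. discrete_topology A) UNIV"
  let ?X = "subst_shift A \<alpha>"
  define cyl where "cyl x r = {y \<in> ?X. \<forall>i\<in>{- int r..int r}. y i = x i}" for x :: "int \<Rightarrow> 'a" and r
  have XA: "range x \<subseteq> A" if "x \<in> ?X" for x
    using that by (simp add: subst_shift_def)
  have open_cyl: "openin (subst_topology A \<alpha>) (cyl x r)" if "x \<in> ?X" for x r
  proof -
    have "cyl x r = {y. range y \<subseteq> A \<and> (\<forall>i\<in>{- int r..int r}. y i = x i)} \<inter> ?X"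
      using XA by (auto simp: cyl_def)
    then show ?thesis
      unfolding subst_topology_def openin_subtopology
      using openin_cylinder[of "{- int r..int r}" x A] XA[OF that] by blast
  qed
  have "continuous_map (subst_topology A \<alpha>) (discrete_topology B) (\<lambda>x. g x 0)"
    using continuous_map_compose[OF assms(2)[unfolded subst_topology_def[of B], THEN continuous_map_into_fulltopology]
        continuous_map_product_projection[of 0 UNIV "\<lambda>_. discrete_topology B"]]
    by (simp add: o_def)
  then have loc: "openin (subst_topology A \<alpha>) {x \<in> ?X. g x 0 = b}" if "b \<in> B" for b
    using openin_continuous_map_preimage[of _ "discrete_topology B" _ "{b}"] that
    by (fastforce simp: topspace_subst_topology)
  have gB: "g x 0 \<in> B" if "x \<in> ?X" for x
    using assms(2) that unfolding continuous_map_def topspace_subst_topology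
    by (auto simp: subst_shift_def)
  have "\<exists>r. \<forall>y\<in>cyl x r. g y 0 = g x 0" if x: "x \<in> ?X" for x
  proof -
    obtain T where T: "openin ?P T" "{y \<in> ?X. g y 0 = g x 0} = T \<inter> ?X"
      using loc[OF gB[OF x]] by (auto simp: subst_topology_def openin_subtopology)
    then have "x \<in> T"
      using x by blast
    then obtain U where U: "finite {i. U i \<noteq> A}" "x \<in> Pi\<^sub>E UNIV U" "Pi\<^sub>E UNIV U \<subseteq> T"
      using T(1) unfolding openin_product_topology_alt by auto
    \<comment> \<open>A basic open set constrains only finitely many coordinates, so membership in
      it is decided by a large enough central window.\<close>
    obtain r where r: "\<And>i. U i \<noteq> A \<Longrightarrow> \<bar>i\<bar> \<le> int r"
    proof -
      have "finite ((\<lambda>i. nat \<bar>i\<bar>) ` {i. U i \<noteq> A})"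
        using U(1) by simp
      then obtain r where "\<forall>s\<in>(\<lambda>i. nat \<bar>i\<bar>) ` {i. U i \<noteq> A}. s \<le> r"
        by (metis finite_nat_set_iff_bounded_le)
      then show ?thesis
        by (intro that[of r]) force
    qed
    have "g y 0 = g x 0" if y: "y \<in> cyl x r" for y
    proof -
      have "y i \<in> U i" for i
      proof (cases "U i = A")
        case True
        then show ?thesis
          using y XA by (auto simp: cyl_def)
      next
        case False
        then have "y i = x i"
          using r[OF False] y by (auto simp: cyl_def abs_le_iff)
        then show ?thesis
          using U(2) by (auto simp: PiE_iff)
      qed
      then have "y \<in> T"
        using U(3) by (auto simp: PiE_iff)
      then show ?thesis
        using T(2) y by (auto simp: cyl_def)
    qed
    then show ?thesis
      by blast
  qed
  then obtain R where R: "\<And>x y. x \<in> ?X \<Longrightarrow> y \<in> cyl x (R x) \<Longrightarrow> g y 0 = g x 0"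
    by metis
  let ?C = "(\<lambda>x. cyl x (R x)) ` ?X"
  have "\<exists>\<F>. finite \<F> \<and> \<F> \<subseteq> ?C \<and> topspace (subst_topology A \<alpha>) \<subseteq> \<Union>\<F>"
    using compact_space_subst_topology[OF assms(1), of \<alpha>] open_cyl
    unfolding compact_space_alt
    by (elim allE[of _ ?C] impE) (auto simp: topspace_subst_topology cyl_def)
  then obtain \<F> where F: "finite \<F>" "\<F> \<subseteq> ?C" "?X \<subseteq> \<Union>\<F>"
    by (auto simp: topspace_subst_topology)
  from finite_subset_image[OF F(1,2)] obtain E
    where "E \<subseteq> ?X" "finite E" "\<F> = (\<lambda>x. cyl x (R x)) ` E"
    by blast
  with F(3) have E: "finite E" "E \<subseteq> ?X" "?X \<subseteq> (\<Union>x\<in>E. cyl x (R x))"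
    by auto
  show ?thesis
  \<comment> \<open>Inserting 0 keeps the maximum meaningful when E is empty.\<close>
  proof (rule that[of "Max (insert 0 (R ` E))"])
    fix x y assume xy: "x \<in> ?X" "y \<in> ?X"
      and eq: "\<And>i. \<bar>i\<bar> \<le> int (Max (insert 0 (R ` E))) \<Longrightarrow> x i = y i"
    obtain e where e: "e \<in> E" "x \<in> cyl e (R e)"
      using E(3) xy(1) by blast
    have "R e \<le> Max (insert 0 (R ` E))"
      using E(1) e(1) by (intro Max_ge) auto
    then have "\<forall>i\<in>{- int (R e)..int (R e)}. x i = y i"
      by (intro ballI eq) auto
    \<comment> \<open>The cylinder around e that contains x also contains y, so both values at 0
      equal that of e.\<close>
    then have "y \<in> cyl e (R e)"
      using e(2) xy(2) by (auto simp: cyl_def)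
    then show "g x 0 = g y 0"
      using R e E(2) by (metis subsetD)
  qed
qed

text \<open>All integer powers of \<open>left_shift\<close>, negative ones included, so that any
  position can be moved to 0.\<close>

definition shift_by :: "int \<Rightarrow> (int \<Rightarrow> 'a) \<Rightarrow> (int \<Rightarrow> 'a)" where
  "shift_by t x = (\<lambda>i. x (i + t))"

lemma shift_by_in_subst_shift:
  assumes "x \<in> subst_shift A \<alpha>"
  shows "shift_by t x \<in> subst_shift A \<alpha>"
proof -
  have "factor (shift_by t x) i n = factor x (i + t) n" for i n
    by (simp add: factor_def shift_by_def algebra_simps)
  then show ?thesis
    using assms by (auto simp: subst_shift_iff shift_by_def)
qed

lemma shift_by_commute:
  assumes "\<And>x. x \<in> subst_shift A \<alpha> \<Longrightarrow> g (left_shift x) = left_shift (g x)" "x \<in> subst_shift A \<alpha>"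
  shows "g (shift_by t x) = shift_by t (g x)"
proof -
  have nat: "g (shift_by (int n) x) = shift_by (int n) (g x)" if "x \<in> subst_shift A \<alpha>" for n x
  proof (induction n)
    case (Suc n)
    have "shift_by (int (Suc n)) y = left_shift (shift_by (int n) y)" for y :: "int \<Rightarrow> 'c"
      by (simp add: shift_by_def left_shift_def algebra_simps)
    moreover have "shift_by (int (Suc n)) y = left_shift (shift_by (int n) y)" for y :: "int \<Rightarrow> 'a"
      by (simp add: shift_by_def left_shift_def algebra_simps)
    moreover have "shift_by (int (Suc n)) y = left_shift (shift_by (int n) y)" for y :: "int \<Rightarrow> 'b"
      by (simp add: shift_by_def left_shift_def algebra_simps)
    ultimately show ?case
      using Suc assms(1) shift_by_in_subst_shift[OF that] by metis
  qed (simp add: shift_by_def)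
  show ?thesis
  proof (cases "t \<ge> 0")
    case True
    then show ?thesis
      using nat[OF assms(2), of "nat t"] by simp
  next
    case False
    \<comment> \<open>For negative t the nonnegative case is applied to \<open>?y\<close>: shifting
      it by - t gives back x.\<close>
    let ?y = "shift_by t x"
    have "g (shift_by (- t) ?y) = shift_by (- t) (g ?y)"
      using nat[OF shift_by_in_subst_shift[OF assms(2)], of "nat (- t)" t] False by simp
    then have "shift_by t (g x) = shift_by t (shift_by (- t) (g ?y))"
      by (simp add: shift_by_def)
    then show ?thesis
      by (simp add: shift_by_def)
  qed
qed

text \<open>Here g is the inverse of the given conjugacy. The local rule is phrased for two
  positions s and t of one sequence, the form needed for counting; it follows by comparing the
  shifts by s and by t at coordinate 0.\<close>

lemma sliding_block_code:
  assumes "finite A" "topologically_conjugate B \<beta> A \<alpha>"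
  obtains g and r :: nat where "\<And>x. x \<in> subst_shift A \<alpha> \<Longrightarrow> g x \<in> subst_shift B \<beta>"
    "\<And>x s t. x \<in> subst_shift A \<alpha> \<Longrightarrow> (\<And>i. \<bar>i\<bar> \<le> int r \<Longrightarrow> x (s + i) = x (t + i)) \<Longrightarrow> g x s = g x t"
proof -
  obtain h where h: "homeomorphic_map (subst_topology B \<beta>) (subst_topology A \<alpha>) h"
    and com: "\<And>x. x \<in> subst_shift B \<beta> \<Longrightarrow> h (left_shift x) = left_shift (h x)"
    using assms(2) by (auto simp: topologically_conjugate_def)
  obtain g where "homeomorphic_maps (subst_topology B \<beta>) (subst_topology A \<alpha>) h g"
    using h homeomorphic_map_maps by blast
  then have cont: "continuous_map (subst_topology A \<alpha>) (subst_topology B \<beta>) g"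
    and gh: "\<And>x. x \<in> subst_shift B \<beta> \<Longrightarrow> g (h x) = x"
    and hg: "\<And>x. x \<in> subst_shift A \<alpha> \<Longrightarrow> h (g x) = x"
    by (auto simp: homeomorphic_maps_def topspace_subst_topology)
  have g: "g x \<in> subst_shift B \<beta>" if "x \<in> subst_shift A \<alpha>" for x
    using cont that unfolding continuous_map_def topspace_subst_topology by auto
  have comm: "g (left_shift x) = left_shift (g x)" if "x \<in> subst_shift A \<alpha>" for x
  proof -
    have "left_shift (g x) \<in> subst_shift B \<beta>"
      using shift_by_in_subst_shift[OF g[OF that], of 1] by (simp add: shift_by_def left_shift_def)
    then show ?thesis
      using gh com[OF g[OF that]] hg[OF that] by metis
  qed
  have sh: "g (shift_by t x) = shift_by t (g x)" if "x \<in> subst_shift A \<alpha>" for x t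
    using shift_by_commute[of A \<alpha> g x t] comm that by blast
  obtain r where r: "\<And>x y. x \<in> subst_shift A \<alpha> \<Longrightarrow> y \<in> subst_shift A \<alpha> \<Longrightarrow>
      (\<And>i. \<bar>i\<bar> \<le> int r \<Longrightarrow> x i = y i) \<Longrightarrow> g x 0 = g y 0"
    using continuous_map_subst_topology_radius[OF assms(1) cont] by blast
  show ?thesis
  proof (rule that[of g r])
    fix x s t assume x: "x \<in> subst_shift A \<alpha>"
      and eq: "\<And>i. \<bar>i\<bar> \<le> int r \<Longrightarrow> x (s + i) = x (t + i)"
    have "g (shift_by s x) 0 = g (shift_by t x) 0"
      using x eq by (intro r) (auto simp: shift_by_in_subst_shift, simp add: shift_by_def add.commute)
    then show "g x s = g x t"
      using sh[OF x] by (simp add: shift_by_def)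
  qed (use g in auto)
qed

section \<open>Bounding the alphabet of a conjugate substitution\<close>

lemma card_conjugate_alphabet_le:
  assumes \<alpha>: "substitution A \<alpha>" "constant_length A \<alpha> L" and L: "L > 1"
    and ne: "subst_shift A \<alpha> \<noteq> {}"
    and \<beta>: "substitution B \<beta>" "inj_on \<beta> B" "primitive_subst B \<beta>" "constant_length B \<beta> L"
    and conj: "topologically_conjugate B \<beta> A \<alpha>"
  shows "card B \<le> card A ^ 4"
proof -
  have A: "finite A" "\<forall>a\<in>A. \<alpha> a \<in> lists A" and B: "\<forall>b\<in>B. \<beta> b \<in> lists B"
    using \<alpha> \<beta> by (auto simp: substitution_def alphabet_def)
  obtain x where x: "x \<in> subst_shift A \<alpha>"
    using ne by blast
  obtain g r where g: "\<And>x. x \<in> subst_shift A \<alpha> \<Longrightarrow> g x \<in> subst_shift B \<beta>"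
    and r: "\<And>x s t. x \<in> subst_shift A \<alpha> \<Longrightarrow>
      (\<And>i. \<bar>i\<bar> \<le> int r \<Longrightarrow> x (s + i) = x (t + i)) \<Longrightarrow> g x s = g x t"
    using sliding_block_code[OF A(1) conj] by blast
  \<comment> \<open>The radius itself serves as the exponent: r < L^r, so a window of radius r
    around a block of length M overhangs it by less than one block on each side.\<close>
  define M where "M = L ^ r"
  have "r < M"
    using L unfolding M_def by (intro power_gt_expt) auto
  define y where "y = subst_seq M (subst_iter \<alpha> r) x"
  have y: "y \<in> subst_shift A \<alpha>"
    using subst_seq_in_subst_shift[OF A(2) \<alpha>(2) _ x] L by (simp add: y_def M_def)
  obtain m where m: "\<And>b. b \<in> B \<Longrightarrow> B \<subseteq> set (subst_iter \<beta> m b)"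
    using \<beta>(3) by (auto simp: primitive_subst_def)
  \<comment> \<open>This power factors as \<beta>^r applied to \<beta>^m(c). By the choice of m, the
    inner word contains every letter d of B, so each \<beta>^r(d) occurs in g y at p plus a multiple
    of M.\<close>
  obtain p c where c: "c \<in> B" "factor (g y) p (L ^ (r + m)) = subst_iter \<beta> (r + m) c"
    using subst_iter_occurs[OF B \<beta>(4) L g[OF y]] by blast
  define w where "w = subst_iter \<beta> m c"
  have cl: "constant_length B (subst_iter \<beta> r) M"
    using constant_length_subst_iter[OF B \<beta>(4)] by (simp add: M_def)
  have w: "w \<in> lists B" "length w = L ^ m"
    using subst_iter_in_lists[OF B c(1)] constant_length_subst_iter[OF B \<beta>(4)] c(1)
    by (auto simp: w_def constant_length_def)
  have "\<exists>e. factor (g y) (p + e * int M) M = subst_iter \<beta> r d" if d: "d \<in> B" for d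
  proof -
    obtain i where i: "i < length w" "w ! i = d"
      using m[OF c(1)] d unfolding w_def by (metis in_set_conv_nth subsetD)
    have "i * M + M \<le> L ^ (r + m)"
    proof -
      have "Suc i * M \<le> length w * M"
        using i(1) by (intro mult_right_mono) auto
      then show ?thesis
        by (simp add: w(2) M_def power_add mult.commute)
    qed
    then have "factor (g y) (p + int (i * M)) M = take M (drop (i * M) (factor (g y) p (L ^ (r + m))))"
      by (rule take_drop_factor[symmetric])
    also have "\<dots> = take M (drop (i * M) (subst_word (subst_iter \<beta> r) w))"
      unfolding c(2) w_def subst_iter_add ..
    also have "\<dots> = subst_iter \<beta> r d"
      using take_drop_subst_word[OF cl w(1) i(1)] i(2) by simp
    finally show ?thesis
      by (intro exI[of _ "int i"]) simp
  qed
  then obtain e where e: "\<And>d. d \<in> B \<Longrightarrow> factor (g y) (p + e d * int M) M = subst_iter \<beta> r d"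
    by metis
  \<comment> \<open>The position p need not be aligned with the blocks of y; q is the block
    containing it.\<close>
  define q where "q = p div int M"
  have "p = q * int M + p mod int M" "0 \<le> p mod int M" "p mod int M < int M"
    using \<open>r < M\<close> by (simp_all add: q_def)
  then have q: "q * int M \<le> p" "p < q * int M + int M"
    by linarith+
  \<comment> \<open>Enlarging the occurrence of \<beta>^r(d) by r on both sides stays within blocks
    q - 1 to q + 2 of y, displaced by e d: one extra block on the left, one on the right, and up to
    two for the unaligned occurrence itself.\<close>
  let ?f = "\<lambda>d. factor x (q + e d - 1) 4"
  have "inj_on ?f B"
  proof (rule inj_onI)
    fix d d' assume d: "d \<in> B" "d' \<in> B" and eq: "?f d = ?f d'"
    have xeq: "x (j + e d) = x (j + e d')" if "q - 1 \<le> j" "j < q + 3" for j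
    proof -
      have "?f d ! nat (j - q + 1) = ?f d' ! nat (j - q + 1)"
        using eq by simp
      then show ?thesis
        using that by (simp add: algebra_simps)
    qed
    \<comment> \<open>Displacement by a multiple of M preserves the place inside a block, so y
      depends only on the letter of x producing that block.\<close>
    have yeq: "y (t + e d * int M) = y (t + e d' * int M)"
      if t: "q * int M - int M \<le> t" "t < q * int M + 3 * int M" for t
    proof -
      have "int M * (q - 1) \<le> t" "t < int M * (q + 3)"
        using t by (simp_all add: algebra_simps)
      moreover have "int M * (t div int M) \<le> t" "t < int M * (t div int M + 1)"
        using \<open>r < M\<close> mult_div_mod_eq[of "int M" t] pos_mod_bound[of "int M" t] pos_mod_sign[of "int M" t]
        unfolding distrib_left by linarith+
      ultimately have "int M * (q - 1) < int M * (t div int M + 1)" "int M * (t div int M) < int M * (q + 3)"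
        by linarith+
      then have "q - 1 \<le> t div int M" "t div int M < q + 3"
        by (simp_all add: mult_less_cancel_left)
      then show ?thesis
        using xeq[of "t div int M"] \<open>r < M\<close> by (simp add: add.commute y_def subst_seq_def)
    qed
    have "factor (g y) (p + e d * int M) M = factor (g y) (p + e d' * int M) M"
    proof (rule nth_equalityI; simp)
      fix k assume k: "k < M"
      show "g y (p + e d * int M + int k) = g y (p + e d' * int M + int k)"
      proof (rule r[OF y])
        fix i assume "\<bar>i\<bar> \<le> int r"
        then have "q * int M - int M \<le> p + int k + i" "p + int k + i < q * int M + 3 * int M"
          using q k \<open>r < M\<close> by linarith+
        from yeq[OF this] show "y (p + e d * int M + int k + i) = y (p + e d' * int M + int k + i)"
          by (simp add: algebra_simps)
      qed
    qed
    then have "subst_iter \<beta> r d = subst_iter \<beta> r d'"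
      using e d by simp
    then show "d = d'"
      using inj_on_subst_iter[OF B \<beta>(4,2)] d by (auto dest: inj_onD)
  qed
  moreover have "?f ` B \<subseteq> {l. set l \<subseteq> A \<and> length l = 4}"
    using x by (auto simp: factor_def subst_shift_def subset_iff image_subset_iff)
  ultimately have "card B \<le> card {l. set l \<subseteq> A \<and> length l = 4}"
    using A(1) by (intro card_inj_on_le) (auto simp: finite_lists_length_eq)
  then show ?thesis
    using A(1) by (simp add: card_lists_length_eq)
qed

subsection \<open>Substitutions on alphabets of bounded size\<close>

text \<open>Each class is recovered from a code by choosing a representative with that code. The
  equivalence lives on a set T of its own, since \<open>renaming\<close> is an equivalence on all
  substitutions while S is restricted.\<close>

lemma finite_quotient_if_finite_code:
  assumes "finite (code ` S)" "equiv T R"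
    and "\<And>x y. x \<in> S \<Longrightarrow> y \<in> S \<Longrightarrow> code x = code y \<Longrightarrow> (x, y) \<in> R"
  shows "finite (S // R)"
proof -
  have "S // R \<subseteq> (\<lambda>c. R `` {SOME y. y \<in> S \<and> code y = c}) ` code ` S"
  proof
    fix K assume "K \<in> S // R"
    then obtain x where x: "x \<in> S" "K = R `` {x}"
      by (auto simp: quotient_def)
    define y where "y = (SOME y. y \<in> S \<and> code y = code x)"
    have "y \<in> S \<and> code y = code x"
      unfolding y_def by (rule someI[of _ x]) (simp add: x)
    then have "R `` {x} = R `` {y}"
      using assms(3)[OF x(1), of y] by (intro equiv_class_eq[OF assms(2)]) auto
    then show "K \<in> (\<lambda>c. R `` {SOME y. y \<in> S \<and> code y = c}) ` code ` S"
      using x by (auto simp: y_def)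
  qed
  then show ?thesis
    using assms(1) by (meson finite_imageI finite_subset)
qed

lemma quotient_mono: "S \<subseteq> T \<Longrightarrow> S // R \<subseteq> T // R"
  by (auto simp: quotient_def)

text \<open>Numbering the letters carries each substitution to an initial segment of the naturals,
  where bounded size leaves finitely many possibilities. Two substitutions with the same numbered
  form are renamings of each other, through one numbering followed by the inverse of the
  other.\<close>

lemma finite_bounded_substitutions_modulo_renaming:
  "finite ({(B :: 'b set, \<beta>). substitution B \<beta> \<and> constant_length B \<beta> L \<and> card B \<le> N} // renaming)"
  (is "finite (?S // _)")
proof -
  define num where "num B = (SOME f. bij_betw f B {..<card B})" for B :: "'b set"
  have num: "bij_betw (num B) B {..<card B}" if "finite B" for B :: "'b set"
    unfolding num_def using someI_ex[OF ex_bij_betw_finite_nat[OF that]]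
    by (simp add: atLeast0LessThan)
  \<comment> \<open>The code is the graph over B, so the values of \<beta> outside its alphabet do
    not enter.\<close>
  define code where "code = (\<lambda>(B, \<beta>). (\<lambda>b. (num B b, map (num B) (\<beta> b))) ` B)"
  have code: "code (B, \<beta>) \<subseteq> {..<N} \<times> {l. set l \<subseteq> {..<N} \<and> length l = L}"
    if B: "substitution B \<beta>" "constant_length B \<beta> L" "card B \<le> N" for B :: "'b set" and \<beta>
  proof (rule subrelI)
    fix i l assume "(i, l) \<in> code (B, \<beta>)"
    then obtain b where b: "b \<in> B" "i = num B b" "l = map (num B) (\<beta> b)"
      by (auto simp: code_def)
    have lt: "num B b < N" if "b \<in> B" for b
      using bij_betwE[OF num[of B]] B that by (force simp: substitution_def alphabet_def)
    have "set (\<beta> b) \<subseteq> B" "length (\<beta> b) = L"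
      using B b by (auto simp: substitution_def constant_length_def)
    then show "(i, l) \<in> {..<N} \<times> {l. set l \<subseteq> {..<N} \<and> length l = L}"
      using b lt by auto
  qed
  have "code ` ?S \<subseteq> Pow ({..<N} \<times> {l. set l \<subseteq> {..<N} \<and> length l = L})"
  proof (intro image_subsetI PowI)
    fix p assume "p \<in> ?S"
    then show "code p \<subseteq> {..<N} \<times> {l. set l \<subseteq> {..<N} \<and> length l = L}"
      using code by (cases p) simp
  qed
  then have "finite (code ` ?S)"
    by (rule finite_subset) (simp add: finite_lists_length_eq)
  then show ?thesis
  proof (rule finite_quotient_if_finite_code[OF _ equiv_renaming], clarify)
    fix B C :: "'b set" and \<beta> \<gamma>
    assume B: "substitution B \<beta>" and C: "substitution C \<gamma>" and eq: "code (B, \<beta>) = code (C, \<gamma>)"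
    have bB: "bij_betw (num B) B {..<card B}" and bC: "bij_betw (num C) C {..<card C}"
      using B C num by (auto simp: substitution_def alphabet_def)
    \<comment> \<open>First components recover the numbered alphabets, so equal codes force equal
      cardinalities.\<close>
    have "fst ` code (B, \<beta>) = num B ` B" "fst ` code (C, \<gamma>) = num C ` C"
      by (force simp: code_def)+
    then have "{..<card B} = {..<card C}"
      using eq bB bC by (metis bij_betw_imp_surj_on)
    then have f: "bij_betw (inv_into C (num C) \<circ> num B) B C" (is "bij_betw ?f B C")
      using bB bij_betw_inv_into[OF bC] by (metis bij_betw_trans)
    have numf: "num C (?f b) = num B b" if "b \<in> B" for b
      using that bB bC \<open>{..<card B} = {..<card C}\<close>
      by (metis bij_betw_apply bij_betw_inv_into_right comp_apply)
    have "\<gamma> (?f b) = map ?f (\<beta> b)" if b: "b \<in> B" for b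
    proof -
      have "(num B b, map (num B) (\<beta> b)) \<in> code (C, \<gamma>)"
        using b unfolding eq[symmetric] by (auto simp: code_def)
      then obtain c where c: "c \<in> C" "num C c = num B b" "map (num C) (\<gamma> c) = map (num B) (\<beta> b)"
        by (auto simp: code_def)
      have "c = ?f b"
        using c(1,2) numf[OF b] bij_betw_apply[OF f b] bC
        by (metis bij_betw_imp_inj_on inj_onD)
      \<comment> \<open>Undoing the numbering of C on the common second component expresses \<gamma>
        c through \<beta> b.\<close>
      have "\<gamma> c = map (inv_into C (num C)) (map (num C) (\<gamma> c))"
        using C c(1) bij_betw_inv_into_left[OF bC]
        by (subst map_map, intro map_idI[symmetric]) (auto simp: substitution_def)
      then show ?thesis
        by (simp only: c(3) map_map flip: \<open>c = ?f b\<close>)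
    qed
    then show "((B, \<beta>), (C, \<gamma>)) \<in> renaming"
      using B C f unfolding renaming_def by blast
  qed
qed

theorem mainTheorem2:
  fixes A :: "'a set" and \<alpha> :: "'a \<Rightarrow> 'a list" and L :: nat
  assumes "substitution A \<alpha>"
    and "primitive_subst A \<alpha>"
    and "constant_length A \<alpha> L"
    and "L > 1"
    and "infinite (subst_shift A \<alpha>)"
  shows "finite ({(B :: 'b set, \<beta> :: 'b \<Rightarrow> 'b list).
            substitution B \<beta> \<and> inj_on \<beta> B \<and> primitive_subst B \<beta> \<and>
            constant_length B \<beta> L \<and> topologically_conjugate B \<beta> A \<alpha>} // renaming)"
proof -
  have "subst_shift A \<alpha> \<noteq> {}"
    using assms(5) by auto
  then have "{(B :: 'b set, \<beta>). substitution B \<beta> \<and> inj_on \<beta> B \<and> primitive_subst B \<beta> \<and>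
      constant_length B \<beta> L \<and> topologically_conjugate B \<beta> A \<alpha>}
    \<subseteq> {(B, \<beta>). substitution B \<beta> \<and> constant_length B \<beta> L \<and> card B \<le> card A ^ 4}"
    using card_conjugate_alphabet_le[OF assms(1,3,4)] by blast
  then show ?thesis
    by (rule finite_subset[OF quotient_mono finite_bounded_substitutions_modulo_renaming])
qed

end
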